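(* Let $D$ be an oriented graph in which, for every vertex $x$, $x^+$ induces a transitive tournament, and let $T\subseteq V(D)$ be a set of vertices inducing a transitive tournament. Then there is a colouring of $V(D)$ with two colours in which each colour class induces an acyclic subdigraph and all vertices of $T$ receive the same colour.
   Context: Digraphs are finite, no loops, no parallel arcs; an oriented graph has no digon. $x^+$ is the out-neighbourhood of $x$. A transitive tournament is an acyclic tournament. *)

theory Defs
  imports Main
begin

definition oriented_graph :: "'a set \<Rightarrow> ('a \<times> 'a) set \<Rightarrow> bool" where
  "oriented_graph V A \<longleftrightarrow> finite V \<and> A \<subseteq> V \<times> V \<and>
     (\<forall>x. (x, x) \<notin> A) \<and> (\<forall>x y. (x, y) \<in> A \<longrightarrow> (y, x) \<notin> A)"

definition induced_arcs :: "('a \<times> 'a) set \<Rightarrow> 'a set \<Rightarrow> ('a \<times> 'a) set" where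
  "induced_arcs A S = A \<inter> (S \<times> S)"

definition out_nbhd :: "('a \<times> 'a) set \<Rightarrow> 'a \<Rightarrow> 'a set" where
  "out_nbhd A x = {y. (x, y) \<in> A}"

definition induces_tournament :: "('a \<times> 'a) set \<Rightarrow> 'a set \<Rightarrow> bool" where
  "induces_tournament A S \<longleftrightarrow>
     (\<forall>x\<in>S. \<forall>y\<in>S. x \<noteq> y \<longrightarrow> ((x, y) \<in> A \<longleftrightarrow> (y, x) \<notin> A))"

definition induces_acyclic :: "('a \<times> 'a) set \<Rightarrow> 'a set \<Rightarrow> bool" where
  "induces_acyclic A S \<longleftrightarrow> acyclic (induced_arcs A S)"

definition induces_transitive_tournament :: "('a \<times> 'a) set \<Rightarrow> 'a set \<Rightarrow> bool" where
  "induces_transitive_tournament A S \<longleftrightarrow> induces_tournament A S \<and> induces_acyclic A S"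

end

theory Submission
  imports Defs "HOL-Combinatorics.Orbits"
begin

text \<open>
  By induction it suffices to treat a strongly connected vertex set \<open>S\<close>. Partition \<open>S\<close> into at least
  two classes, as few as possible, such that every vertex dominated from outside its class by a
  vertex of a class \<open>X\<close> is dominated by all of \<open>X\<close>. The vertices dominated by \<open>X\<close> from outside then
  form a transitive tournament; call the class of its source the successor of \<open>X\<close>. The
  classes along a cycle of the successor map can be merged, so by minimality this cycle
  contains all classes \<open>Y\<^sub>0, \<dots>, Y\<^sub>n\<^sub>-\<^sub>1\<close>, and an arc from \<open>Y\<^sub>i\<close> to \<open>b \<in> Y\<^sub>j\<close> forces all classes cyclically
  between \<open>Y\<^sub>i\<close> and \<open>Y\<^sub>j\<close> to dominate \<open>b\<close>. In particular the vertices at which \<open>Y\<^sub>j\<close> can be entered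
  form a transitive tournament.

  Let the source of \<open>T\<close> lie in \<open>Y\<^sub>0\<close> and let \<open>Y\<^sub>K\<close> be the last class dominated somewhere by \<open>Y\<^sub>0\<close>. Colour
  each class by induction, such that \<open>T \<inter> Y\<^sub>0\<close> and the entries of \<open>Y\<^sub>1, \<dots>, Y\<^sub>K\<close> get the first colour and
  the entries of the later classes get the second. A monochromatic cycle meeting several classes
  enters each of them at an entry and, in the second colour, cannot leave \<open>Y\<^sub>0\<close>; hence it stays
  within \<open>Y\<^sub>0, \<dots>, Y\<^sub>K\<close> or within \<open>Y\<^sub>K\<^sub>+\<^sub>1, \<dots>, Y\<^sub>n\<^sub>-\<^sub>1\<close>, but neither interval has arcs
  going backwards.
\<close>

section \<open>Sources of transitive tournaments; acyclicity from ranks\<close>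

lemma induces_transitive_tournament_subset:
  assumes "induces_transitive_tournament A T" "T' \<subseteq> T"
  shows "induces_transitive_tournament A T'"
proof -
  have "induced_arcs A T' \<subseteq> induced_arcs A T"
    using assms(2) by (auto simp: induced_arcs_def)
  then show ?thesis
    using assms unfolding induces_transitive_tournament_def induces_tournament_def
      induces_acyclic_def by (meson acyclic_subset subsetD)
qed

lemma transitive_tournament_source:
  assumes "induces_transitive_tournament A T" "finite T" "T \<noteq> {}"
  obtains s where "s \<in> T" "\<And>t. t \<in> T \<Longrightarrow> t \<noteq> s \<Longrightarrow> (s, t) \<in> A"
proof -
  have "finite (induced_arcs A T)"
    using assms(2) by (auto simp: induced_arcs_def intro: finite_subset[of _ "T \<times> T"])
  then have "wf (induced_arcs A T)"
    using assms(1) finite_acyclic_wf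
    unfolding induces_transitive_tournament_def induces_acyclic_def by blast
  then obtain s where s: "s \<in> T" "\<And>y. (y, s) \<in> induced_arcs A T \<Longrightarrow> y \<notin> T"
    using assms(3) by (metis ex_in_conv wfE_min)
  have "(s, t) \<in> A" if "t \<in> T" "t \<noteq> s" for t
  proof -
    have "(t, s) \<notin> A"
      using s(1) s(2)[of t] that by (auto simp: induced_arcs_def)
    then show ?thesis
      using assms(1) s(1) that
      unfolding induces_transitive_tournament_def induces_tournament_def by blast
  qed
  with s(1) show thesis
    using that by blast
qed

text \<open>The rank cannot drop along a closed walk, so it is constant there and the walk lies in
  one fibre.\<close>

lemma acyclic_by_rank:
  fixes g :: "'a \<Rightarrow> nat"
  assumes mono: "\<And>a b. (a, b) \<in> r \<Longrightarrow> g a \<le> g b"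
    and fibre: "\<And>m. acyclic (r \<inter> {(a, b). g a = m \<and> g b = m})"
  shows "acyclic r"
proof (rule acyclicI, safe)
  fix x assume x: "(x, x) \<in> r\<^sup>+"
  have le: "g a \<le> g b" if "(a, b) \<in> r\<^sup>+" for a b
    using that by (induction) (auto dest: mono)
  have "g y = g x \<longrightarrow> (x, y) \<in> (r \<inter> {(a, b). g a = g x \<and> g b = g x})\<^sup>+" if "(x, y) \<in> r\<^sup>+" for y
    using that
  proof induction
    case (base y)
    then show ?case by auto
  next
    case (step y z)
    show ?case
    proof
      assume z: "g z = g x"
      with step have "g y = g x"
        using le mono by (metis le_antisym)
      with step z show "(x, z) \<in> (r \<inter> {(a, b). g a = g x \<and> g b = g x})\<^sup>+"
        by (auto intro: trancl_into_trancl)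
    qed
  qed
  with x fibre[of "g x"] show False
    by (auto simp: acyclic_def)
qed

lemma induces_acyclic_subset:
  assumes "induces_acyclic A Y" "X \<subseteq> Y"
  shows "induces_acyclic A X"
proof -
  have "induced_arcs A X \<subseteq> induced_arcs A Y"
    using assms(2) by (auto simp: induced_arcs_def)
  with assms(1) show ?thesis
    unfolding induces_acyclic_def by (rule acyclic_subset)
qed

lemma induces_acyclic_by_rank:
  fixes g :: "'a \<Rightarrow> nat"
  assumes "\<And>a b. a \<in> X \<Longrightarrow> b \<in> X \<Longrightarrow> (a, b) \<in> A \<Longrightarrow> g a \<le> g b"
    and "\<And>m. induces_acyclic A {v \<in> X. g v = m}"
  shows "induces_acyclic A X"
proof -
  have "acyclic (induced_arcs A X \<inter> {(a, b). g a = m \<and> g b = m})" for m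
    using assms(2)[of m] unfolding induces_acyclic_def
    by (rule acyclic_subset) (auto simp: induced_arcs_def)
  moreover have "g a \<le> g b" if "(a, b) \<in> induced_arcs A X" for a b
    using assms(1) that by (auto simp: induced_arcs_def)
  ultimately show ?thesis
    unfolding induces_acyclic_def by (rule acyclic_by_rank[rotated])
qed

section \<open>Homogeneous partitions and the successor map\<close>

text \<open>No vertex set is fixed: the induction shrinks the set to be coloured, while
  \<open>A\<close> and its out-neighbourhoods stay the same.\<close>

locale locally_out_transitive =
  fixes A :: "('a \<times> 'a) set"
  assumes asym: "(x, y) \<in> A \<Longrightarrow> (y, x) \<notin> A"
    and out_transitive: "induces_transitive_tournament A (out_nbhd A x)"
begin

lemma out_subset_transitive:
  assumes "\<And>b. b \<in> B \<Longrightarrow> (x, b) \<in> A"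
  shows "induces_transitive_tournament A B"
  using assms induces_transitive_tournament_subset[OF out_transitive[of x], of B]
  by (auto simp: out_nbhd_def)

text \<open>Cut form of strong connectivity of the subdigraph induced by \<open>S\<close>; its
  negation directly supplies a set that no arc leaves.\<close>

definition strongly_connected :: "'a set \<Rightarrow> bool" where
  "strongly_connected S \<longleftrightarrow>
     (\<forall>X. X \<subset> S \<longrightarrow> X \<noteq> {} \<longrightarrow> (\<exists>a\<in>X. \<exists>b\<in>S - X. (a, b) \<in> A))"

text \<open>A partition is encoded by the fibres of \<open>h\<close>; the free label type admits
  both vertices and numbers as labels.\<close>

definition out_homogeneous :: "'a set \<Rightarrow> ('a \<Rightarrow> 'b) \<Rightarrow> bool" where
  "out_homogeneous S h \<longleftrightarrow>
     (\<forall>a\<in>S. \<forall>b\<in>S. \<forall>v\<in>S. (a, b) \<in> A \<longrightarrow> h a \<noteq> h b \<longrightarrow> h v = h a \<longrightarrow> (v, b) \<in> A)"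

lemma out_homogeneousD:
  assumes "out_homogeneous S h" "(a, b) \<in> A" "h a \<noteq> h b" "h v = h a" "a \<in> S" "b \<in> S" "v \<in> S"
  shows "(v, b) \<in> A"
  using assms unfolding out_homogeneous_def by blast

text \<open>By homogeneity a single vertex of class \<open>p\<close> dominates all that the class
  dominates outside itself, so this set \<open>N\<close> has a source \<open>s\<close>. Take
  \<open>g p\<close> to be the class of \<open>s\<close>; homogeneity spreads the arcs leaving
  \<open>s\<close> to that whole class.\<close>

lemma next_class:
  assumes fin: "finite S" and hom: "out_homogeneous S h"
    and strong: "strongly_connected S"
    and card: "2 \<le> card (h ` S)"
  obtains g where "\<And>p. p \<in> h ` S \<Longrightarrow> g p \<in> h ` S" "\<And>p. p \<in> h ` S \<Longrightarrow> g p \<noteq> p"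
    "\<And>a b v. \<lbrakk>a \<in> S; b \<in> S; v \<in> S; (a, b) \<in> A; h a \<noteq> h b; g (h a) \<noteq> h b; h v = g (h a)\<rbrakk>
       \<Longrightarrow> (v, b) \<in> A"
proof -
  have "\<exists>q. q \<in> h ` S \<and> q \<noteq> p \<and>
      (\<forall>a\<in>S. \<forall>b\<in>S. \<forall>v\<in>S. (a, b) \<in> A \<longrightarrow> h a = p \<longrightarrow> h a \<noteq> h b \<longrightarrow> q \<noteq> h b \<longrightarrow> h v = q
          \<longrightarrow> (v, b) \<in> A)" if p: "p \<in> h ` S" for p
  proof -
    define X where "X = {a \<in> S. h a = p}"
    define N where "N = {b \<in> S. h b \<noteq> p \<and> (\<exists>a\<in>X. (a, b) \<in> A)}"
    have "X \<noteq> {}"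
      using p by (auto simp: X_def)
    moreover have "X \<noteq> S"
    proof
      assume "X = S"
      then have "h ` S \<subseteq> {p}"
        by (auto simp: X_def)
      then have "card (h ` S) \<le> 1"
        by (metis card_mono card.empty card_insert_disjoint empty_iff finite.intros One_nat_def)
      with card show False by simp
    qed
    moreover have "X \<subseteq> S"
      by (auto simp: X_def)
    ultimately have "\<exists>a\<in>X. \<exists>b\<in>S - X. (a, b) \<in> A"
      using strong unfolding strongly_connected_def by blast
    then have N: "N \<noteq> {}"
      by (auto simp: N_def X_def)
    from \<open>X \<noteq> {}\<close> obtain x where x: "x \<in> X" by blast
    have xN: "(x, b) \<in> A" if "b \<in> N" for b
      using that x out_homogeneousD[OF hom] unfolding N_def X_def by auto
    then have "induces_transitive_tournament A N"
      by (rule out_subset_transitive)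
    then obtain s where s: "s \<in> N" "\<And>t. t \<in> N \<Longrightarrow> t \<noteq> s \<Longrightarrow> (s, t) \<in> A"
      using transitive_tournament_source[of A N] N fin unfolding N_def by auto
    show ?thesis
    proof (intro exI[of _ "h s"] conjI ballI impI)
      show "h s \<in> h ` S" "h s \<noteq> p"
        using s(1) by (auto simp: N_def)
      fix a b v assume *: "a \<in> S" "b \<in> S" "v \<in> S" "(a, b) \<in> A" "h a = p" "h a \<noteq> h b"
        "h s \<noteq> h b" "h v = h s"
      then have "b \<in> N" "b \<noteq> s"
        by (auto simp: N_def X_def)
      then have "(s, b) \<in> A"
        using s(2) by blast
      with * s(1) show "(v, b) \<in> A"
        using out_homogeneousD[OF hom, of s b v] by (auto simp: N_def)
    qed
  qed
  then obtain g where "\<And>p. p \<in> h ` S \<Longrightarrow> g p \<in> h ` S \<and> g p \<noteq> p \<and>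
      (\<forall>a\<in>S. \<forall>b\<in>S. \<forall>v\<in>S. (a, b) \<in> A \<longrightarrow> h a = p \<longrightarrow> h a \<noteq> h b \<longrightarrow> g p \<noteq> h b \<longrightarrow> h v = g p
          \<longrightarrow> (v, b) \<in> A)"
    by metis
  then show thesis
    using that[of g] by (simp add: image_iff) blast
qed

text \<open>A smallest nonempty \<open>g\<close>-closed set \<open>Q\<close> of labels is a cycle.
  If it missed a class, merging \<open>Q\<close> would give a homogeneous labelling with fewer, but
  still at least two, classes.\<close>

lemma cyclic_class_structure:
  assumes fin: "finite S" and card: "2 \<le> card S"
    and strong: "strongly_connected S"
  obtains h :: "'a \<Rightarrow> 'a" and g where "out_homogeneous S h" "2 \<le> card (h ` S)"
    "\<And>p. p \<in> h ` S \<Longrightarrow> orbit g p = h ` S"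
    "\<And>a b v. \<lbrakk>a \<in> S; b \<in> S; v \<in> S; (a, b) \<in> A; h a \<noteq> h b; g (h a) \<noteq> h b; h v = g (h a)\<rbrakk>
       \<Longrightarrow> (v, b) \<in> A"
proof -
  define good where "good h \<longleftrightarrow> out_homogeneous S h \<and> 2 \<le> card (h ` S)" for h :: "'a \<Rightarrow> 'a"
  \<comment> \<open>Singleton classes are homogeneous, so a labelling with fewest classes
    exists.\<close>
  have "good id"
    using card by (auto simp: good_def out_homogeneous_def)
  then obtain h where h: "good h" and least: "\<And>h'. good h' \<Longrightarrow> card (h ` S) \<le> card (h' ` S)"
    using ex_has_least_nat[of good id "\<lambda>h. card (h ` S)"] by blast
  from h have hom: "out_homogeneous S h" and card_h: "2 \<le> card (h ` S)"
    by (auto simp: good_def)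
  obtain g where g: "\<And>p. p \<in> h ` S \<Longrightarrow> g p \<in> h ` S" "\<And>p. p \<in> h ` S \<Longrightarrow> g p \<noteq> p"
    and step: "\<And>a b v. \<lbrakk>a \<in> S; b \<in> S; v \<in> S; (a, b) \<in> A; h a \<noteq> h b; g (h a) \<noteq> h b; h v = g (h a)\<rbrakk>
       \<Longrightarrow> (v, b) \<in> A"
    by (rule next_class[OF fin hom strong card_h]) (rule that)
  define closed where "closed Q \<longleftrightarrow> Q \<subseteq> h ` S \<and> Q \<noteq> {} \<and> g ` Q \<subseteq> Q" for Q
  have "closed (h ` S)"
    using g card_h by (auto simp: closed_def)
  then obtain Q where Q: "closed Q" and Qleast: "\<And>R. closed R \<Longrightarrow> card Q \<le> card R"
    using ex_has_least_nat[of closed "h ` S" card] by blast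
  have finQ: "finite Q"
    using Q fin finite_subset unfolding closed_def by blast
  have orbQ: "orbit g p = Q" if p: "p \<in> Q" for p
  proof -
    have "orbit g p \<subseteq> Q"
    proof
      fix q assume "q \<in> orbit g p"
      then show "q \<in> Q"
        using p Q by induction (auto simp: closed_def)
    qed
    moreover have "closed (orbit g p)"
      using calculation Q orbit_nonempty[of g p] by (auto simp: closed_def intro: orbit.step)
    ultimately show ?thesis
      using Qleast finQ by (metis card_seteq)
  qed
  have "Q = h ` S"
  proof (rule ccontr)
    assume ne: "Q \<noteq> h ` S"
    obtain q where q: "q \<in> Q"
      using Q by (auto simp: closed_def)
    have gq: "g q \<in> Q" "g q \<noteq> q"
      using q Q g by (auto simp: closed_def)
    define h' where "h' v = (if h v \<in> Q then q else h v)" for v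
    have dominate: "(v, b) \<in> A" if "a \<in> S" "b \<in> S" "(a, b) \<in> A" "h a \<in> Q" "h b \<notin> Q"
      and v: "v \<in> S" "h v \<in> Q" for a b v
    proof -
      have "h v \<in> orbit g (h a)"
        using orbQ that by blast
      \<comment> \<open>Quantifying over a whole class lets the induction along the orbit pass to
        the next class; the class of \<open>b\<close> is never met, as it lies outside
        \<open>Q\<close>.\<close>
      then have "\<forall>w\<in>S. h w = h v \<longrightarrow> (w, b) \<in> A"
      proof induction
        case base
        then show ?case
          using step[of a b] that Q by (metis closed_def image_subset_iff)
      next
        case (step y)
        have "y \<in> Q"
          using step.hyps orbQ that by blast
        then obtain w where w: "w \<in> S" "h w = y"
          using Q by (auto simp: closed_def)
        with step.IH have wb: "(w, b) \<in> A" by blast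
        have "g y \<in> Q"
          using \<open>y \<in> Q\<close> Q by (auto simp: closed_def)
        then show ?case
          using \<open>\<And>a b v. \<lbrakk>a \<in> S; b \<in> S; v \<in> S; (a, b) \<in> A; h a \<noteq> h b; g (h a) \<noteq> h b; h v = g (h a)\<rbrakk>
            \<Longrightarrow> (v, b) \<in> A\<close>[of w b] w wb that \<open>y \<in> Q\<close> by metis
      qed
      then show ?thesis
        using v by blast
    qed
    have "out_homogeneous S h'"
      unfolding out_homogeneous_def
    proof (intro ballI impI)
      fix a b v assume *: "a \<in> S" "b \<in> S" "v \<in> S" "(a, b) \<in> A" "h' a \<noteq> h' b" "h' v = h' a"
      show "(v, b) \<in> A"
      proof (cases "h a \<in> Q")
        case True
        with * q have "h b \<notin> Q" "h v \<in> Q"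
          by (auto simp: h'_def split: if_splits)
        with * True show ?thesis
          using dominate by blast
      next
        case False
        with * q have "h a \<noteq> h b" "h v = h a"
          by (auto simp: h'_def split: if_splits)
        with * show ?thesis
          using out_homogeneousD[OF hom] by blast
      qed
    qed
    moreover have "2 \<le> card (h' ` S)"
    proof -
      obtain p where p: "p \<in> h ` S" "p \<notin> Q"
        using ne Q by (auto simp: closed_def)
      then have "{p, q} \<subseteq> h' ` S"
        using q Q by (auto simp: h'_def closed_def image_iff subset_iff)
      moreover have "card {p, q} = 2"
        using p q by (metis card_2_iff)
      ultimately show ?thesis
        using fin by (metis card_mono finite_imageI)
    qed
    ultimately have "card (h ` S) \<le> card (h' ` S)"
      using least by (simp add: good_def)
    \<comment> \<open>The label \<open>g q\<close> is lost in the merge, as it lies in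
      \<open>Q\<close> and differs from \<open>q\<close>; so the number of classes drops.\<close>
    moreover have "h' ` S \<subseteq> h ` S - {g q}"
      using q Q gq by (auto simp: h'_def closed_def)
    moreover have "g q \<in> h ` S"
      using gq Q by (auto simp: closed_def)
    ultimately show False
      using fin psubset_card_mono[of "h ` S" "h' ` S"] by fastforce
  qed
  with orbQ have "\<And>p. p \<in> h ` S \<Longrightarrow> orbit g p = h ` S"
    by simp
  from that[OF hom card_h this step] show thesis .
qed

section \<open>Cyclic numbering of the classes\<close>

text \<open>A class is numbered by the exponent of \<open>g\<close> that leads to it from the class
  of \<open>t\<close>. The alternative with \<open>Suc (k a) = n\<close> is the step from the last
  class back to class 0.\<close>

lemma cyclic_numbering:
  assumes "finite S" and "2 \<le> card S" and t: "t \<in> S"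
    and "strongly_connected S"
  obtains k :: "'a \<Rightarrow> nat" and n where "out_homogeneous S k" "k ` S = {..<n}" "2 \<le> n" "k t = 0"
    "\<And>a b v. \<lbrakk>a \<in> S; b \<in> S; v \<in> S; (a, b) \<in> A; k a \<noteq> k b; k v \<noteq> k b;
       k v = Suc (k a) \<or> Suc (k a) = n \<and> k v = 0\<rbrakk> \<Longrightarrow> (v, b) \<in> A"
proof -
  obtain h :: "'a \<Rightarrow> 'a" and g where hom: "out_homogeneous S h" and card: "2 \<le> card (h ` S)"
    and orb: "\<And>p. p \<in> h ` S \<Longrightarrow> orbit g p = h ` S"
    and step: "\<And>a b v. \<lbrakk>a \<in> S; b \<in> S; v \<in> S; (a, b) \<in> A; h a \<noteq> h b; g (h a) \<noteq> h b; h v = g (h a)\<rbrakk>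
       \<Longrightarrow> (v, b) \<in> A"
    by (rule cyclic_class_structure[OF assms(1,2,4)]) (rule that)
  define p where "p = h t"
  \<comment> \<open>The least positive exponent returning to \<open>p\<close>, hence the length of
    the cycle.\<close>
  define n where "n = funpow_dist1 g p p"
  define e where "e m = (g ^^ m) p" for m
  have p: "p \<in> orbit g p" and P: "orbit g p = h ` S"
    using orb t by (auto simp: p_def)
  have bij: "bij_betw e {..<n} (h ` S)"
    using inj_on_funpow_dist1[OF p] orbit_conv_funpow_dist1[OF p] P
    unfolding bij_betw_def n_def e_def by (simp add: atLeast0LessThan)
  have e0: "e 0 = p" and eS: "e (Suc m) = g (e m)" for m
    by (auto simp: e_def)
  have en: "e n = p"
    using funpow_dist1_prop[OF p] by (simp add: e_def n_def)
  have n: "n = card (h ` S)"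
    using bij_betw_same_card[OF bij] by simp
  define k where "k v = the_inv_into {..<n} e (h v)" for v
  have ek: "e (k v) = h v" and kn: "k v < n" if "v \<in> S" for v
    using bij that f_the_inv_into_f_bij_betw[OF bij]
      bij_betwE[OF bij_betw_the_inv_into[OF bij]] unfolding k_def by auto
  have k_eq: "k a = k b \<longleftrightarrow> h a = h b" if "a \<in> S" "b \<in> S" for a b
    using ek that by (metis k_def)
  show thesis
  proof (rule that)
    show "out_homogeneous S k"
      using hom k_eq unfolding out_homogeneous_def by blast
    show "k ` S = {..<n}"
      using bij_betw_imp_surj_on[OF bij_betw_the_inv_into[OF bij]]
      unfolding k_def image_image by simp
    show "2 \<le> n"
      using n card by simp
    then show "k t = 0"
      using ek[OF t] kn[OF t] e0 bij unfolding p_def bij_betw_def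
      by (metis inj_onD lessThan_iff less_le_trans zero_less_numeral)
    fix a b v assume *: "a \<in> S" "b \<in> S" "v \<in> S" "(a, b) \<in> A" "k a \<noteq> k b" "k v \<noteq> k b"
       "k v = Suc (k a) \<or> Suc (k a) = n \<and> k v = 0"
    then have "h v = g (h a)"
      using ek e0 eS en by metis
    with * show "(v, b) \<in> A"
      using step k_eq by metis
  qed
qed

section \<open>Colouring the numbered classes\<close>

text \<open>The assumption \<open>smaller\<close> is the induction hypothesis; it is applied to the
  single classes, which are proper subsets because \<open>2 <= n\<close>.\<close>

lemma two_colouring_of_numbered:
  assumes fin: "finite S" and hom: "out_homogeneous S k" and kS: "k ` S = {..<n}" and n: "2 \<le> n"
    and t: "t \<in> T" "k t = 0" "\<And>x. x \<in> T \<Longrightarrow> x \<noteq> t \<Longrightarrow> (t, x) \<in> A"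
    and T: "T \<subseteq> S" "induces_transitive_tournament A T"
    and cyc: "\<And>a b v. \<lbrakk>a \<in> S; b \<in> S; v \<in> S; (a, b) \<in> A; k a \<noteq> k b; k v \<noteq> k b;
       k v = Suc (k a) \<or> Suc (k a) = n \<and> k v = 0\<rbrakk> \<Longrightarrow> (v, b) \<in> A"
    and strong: "strongly_connected S"
    and smaller: "\<And>S' T'. \<lbrakk>S' \<subset> S; T' \<subseteq> S'; induces_transitive_tournament A T'\<rbrakk> \<Longrightarrow>
       \<exists>c :: 'a \<Rightarrow> bool. (\<forall>i. induces_acyclic A {v\<in>S'. c v = i}) \<and> (\<forall>x\<in>T'. c x)"
  shows "\<exists>c :: 'a \<Rightarrow> bool. (\<forall>i. induces_acyclic A {v\<in>S. c v = i}) \<and> (\<forall>x\<in>T. c x)"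
proof -
  have class_ne: "\<exists>v\<in>S. k v = l" if "l < n" for l
    using kS that by (metis imageE lessThan_iff)
  have k_less: "k v < n" if "v \<in> S" for v
    using kS that by blast
  \<comment> \<open>The class of \<open>b\<close> is not among the classes \<open>k a\<close> to
    \<open>l\<close>, so \<open>cyc\<close> passes the arc into \<open>b\<close> on from class to
    class.\<close>
  have advance: "(v, b) \<in> A"
    if "a \<in> S" "b \<in> S" "(a, b) \<in> A" "k a \<le> l" "l < n" "k b < k a \<or> l < k b" "v \<in> S" "k v = l"
    for a b v l
  proof -
    have "\<forall>v\<in>S. k v = l \<longrightarrow> (v, b) \<in> A"
      using that(4-6)
    proof (induction rule: dec_induct)
      case base
      then show ?case
        using out_homogeneousD[OF hom, of a b] that by auto
    next
      case (step m)
      obtain w where "w \<in> S" "k w = m"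
        using class_ne[of m] step by auto
      then have "(w, b) \<in> A"
        using step.IH step.prems step.hyps by auto
      then show ?case
        using cyc[OF \<open>w \<in> S\<close> \<open>b \<in> S\<close>] \<open>k w = m\<close> step.hyps step.prems by auto
    qed
    with that show ?thesis by blast
  qed
  have last_class: "(v, b) \<in> A"
    if "a \<in> S" "b \<in> S" "(a, b) \<in> A" "k b < k a" "v \<in> S" "Suc (k v) = n" for a b v
    using advance[of a b "k v" v] that k_less[of a] by auto
  \<comment> \<open>Up to class \<open>n - 1\<close>, across to class 0, and up again to the class
    of \<open>v\<close>, stopping short of the class of \<open>b\<close>.\<close>
  have wrap: "(v, b) \<in> A"
    if "a \<in> S" "b \<in> S" "(a, b) \<in> A" "k b < k a" "v \<in> S" "k v < k b" for a b v
  proof -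
    obtain w where w: "w \<in> S" "Suc (k w) = n"
      using class_ne[of "n - 1"] n by auto
    obtain z where z: "z \<in> S" "k z = 0"
      using class_ne[of 0] n by auto
    have "(w, b) \<in> A"
      using last_class that w by blast
    then have "(z, b) \<in> A"
      using cyc[of w b z] w z that k_less[of a] by auto
    then show ?thesis
      using advance[of z b "k v" v] z that k_less[of b] by auto
  qed
  \<comment> \<open>Hence the entries of a class other than class 0 are all out-neighbours of one
    vertex of the preceding class.\<close>
  have prev: "(x, b) \<in> A"
    if "a \<in> S" "b \<in> S" "(a, b) \<in> A" "k a \<noteq> k b" "x \<in> S" "Suc (k x) = k b" for a b x
  proof (cases "k a < k b")
    case True
    show ?thesis
      by (rule advance[of a b "k x" x]) (use that True k_less[of x] in linarith)+
  next
    case False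
    show ?thesis
      by (rule wrap[of a b x]) (use that False in linarith)+
  qed

  define K where "K = Max {k b | b. b \<in> S \<and> k b \<noteq> 0 \<and> (\<exists>a\<in>S. k a = 0 \<and> (a, b) \<in> A)}"
    (is "_ = Max ?J")
  have finJ: "finite ?J"
    using fin by simp
  have "?J \<noteq> {}"
  proof -
    let ?X = "{v \<in> S. k v = 0}"
    have "?X \<subset> S" "?X \<noteq> {}"
      using class_ne[of 0] class_ne[of 1] n by force+
    then have "\<exists>a\<in>?X. \<exists>b\<in>S - ?X. (a, b) \<in> A"
      using strong unfolding strongly_connected_def by blast
    then show ?thesis by auto
  qed
  then have "K \<in> ?J"
    unfolding K_def using Max_in finJ by blast
  then obtain b' a' where b': "b' \<in> S" "k b' = K" "K \<noteq> 0" "a' \<in> S" "k a' = 0" "(a', b') \<in> A"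
    by auto
  have Kmax: "k b \<le> K" if "a \<in> S" "b \<in> S" "(a, b) \<in> A" "k a = 0" for a b
    using that Max_ge[OF finJ, of "k b"] unfolding K_def[symmetric] by (cases "k b = 0") auto
  have no_back_low: "k a < k b"
    if "a \<in> S" "b \<in> S" "(a, b) \<in> A" "k a \<noteq> k b" "k a \<le> K" for a b
  proof (rule ccontr)
    assume "\<not> k a < k b"
    with that have less: "k b < k a" by simp
    \<comment> \<open>The arc into \<open>b\<close> moves up to class \<open>K\<close>, and the arc
      from \<open>a'\<close> into \<open>b'\<close> moves up to the class of \<open>b\<close>: a
      digon.\<close>
    then have "(b', b) \<in> A"
      using advance[of a b K b'] that b' k_less[of b'] by auto
    moreover have "(b, b') \<in> A"
      using advance[of a' b' "k b" b] that b' less k_less[of b] by auto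
    ultimately show False
      using asym by blast
  qed
  have no_back_high: "k a < k b"
    if "a \<in> S" "b \<in> S" "(a, b) \<in> A" "k a \<noteq> k b" "K < k b" for a b
  proof (rule ccontr)
    assume "\<not> k a < k b"
    with that have "k b < k a" by simp
    \<comment> \<open>The arc wraps around to class 0, which dominates nothing beyond class
      \<open>K\<close>.\<close>
    then have "(a', b) \<in> A"
      using wrap[of a b a'] that b' by auto
    then show False
      using Kmax[of a' b] that b' by auto
  qed

  \<comment> \<open>The vertices of class \<open>l\<close> whose colour is prescribed. In class 0
    this is the part of \<open>T\<close>, and the entries remain free.\<close>
  define M where "M l = (if l = 0 then {v \<in> T. k v = 0}
    else {b \<in> S. k b = l \<and> (\<exists>a\<in>S. k a \<noteq> l \<and> (a, b) \<in> A)})" for l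
  have M_tournament: "induces_transitive_tournament A (M l)" if l: "l < n" for l
  proof (cases l)
    case 0
    then show ?thesis
      using induces_transitive_tournament_subset[OF T(2), of "M l"] by (auto simp: M_def)
  next
    case (Suc m)
    obtain x where "x \<in> S" "k x = m"
      using class_ne[of m] l Suc by auto
    then show ?thesis
      using prev[of _ _ x] Suc by (intro out_subset_transitive[of _ x]) (auto simp: M_def)
  qed
  have "\<forall>l\<in>{..<n}. \<exists>c :: 'a \<Rightarrow> bool.
      (\<forall>i. induces_acyclic A {v. v \<in> S \<and> k v = l \<and> c v = i}) \<and> (\<forall>x\<in>M l. c x = (l \<le> K))"
  proof
    fix l assume "l \<in> {..<n}"
    then have l: "l < n" by simp
    let ?S = "{v \<in> S. k v = l}"
    obtain w where "w \<in> S" "k w \<noteq> l"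
      using class_ne[of 0] class_ne[of 1] n by (cases "l = 0") force+
    then have sub: "?S \<subset> S" by blast
    have "M l \<subseteq> ?S"
      using T(1) by (auto simp: M_def split: if_splits)
    from smaller[OF sub this M_tournament[OF l]] obtain c :: "'a \<Rightarrow> bool"
      where c: "\<And>i. induces_acyclic A {v \<in> ?S. c v = i}" "\<And>x. x \<in> M l \<Longrightarrow> c x"
      by auto
    \<comment> \<open>The colouring \<open>c\<close> is True on \<open>M l\<close>; comparing it
      with \<open>l <= K\<close> swaps the colours in classes beyond \<open>K\<close>.\<close>
    have "induces_acyclic A {v. v \<in> S \<and> k v = l \<and> (c v = (l \<le> K)) = i}" for i
      using c(1)[of "i = (l \<le> K)"] by (rule back_subst[of "induces_acyclic A"]) auto
    with c(2) show "\<exists>c :: 'a \<Rightarrow> bool.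
        (\<forall>i. induces_acyclic A {v. v \<in> S \<and> k v = l \<and> c v = i}) \<and> (\<forall>x\<in>M l. c x = (l \<le> K))"
      by (intro exI[of _ "\<lambda>v. c v = (l \<le> K)"]) auto
  qed
  from bchoice[OF this] obtain cc :: "nat \<Rightarrow> 'a \<Rightarrow> bool"
    where "\<forall>l\<in>{..<n}. (\<forall>i. induces_acyclic A {v. v \<in> S \<and> k v = l \<and> cc l v = i}) \<and>
      (\<forall>x\<in>M l. cc l x = (l \<le> K))" ..
  then have cc: "\<And>l i. l < n \<Longrightarrow> induces_acyclic A {v. v \<in> S \<and> k v = l \<and> cc l v = i}"
      "\<And>l x. l < n \<Longrightarrow> x \<in> M l \<Longrightarrow> cc l x = (l \<le> K)"
    by simp_all
  define c where "c v = cc (k v) v" for v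
  have entry: "c b = (k b \<le> K)"
    if "a \<in> S" "b \<in> S" "(a, b) \<in> A" "k a \<noteq> k b" "k b \<noteq> 0" for a b
  proof -
    have "b \<in> M (k b)"
      using that by (auto simp: M_def)
    then show ?thesis
      using cc(2) k_less that unfolding c_def by blast
  qed
  \<comment> \<open>Second-colour vertices of \<open>Y\<^sub>0\<close> cannot leave it, since \<open>Y\<^sub>0\<close> only dominates first-colour entries;
    so \<open>Y\<^sub>0\<close> ranks last there. First-colour vertices beyond \<open>K\<close> cannot be entered, so they rank first.\<close>
  define rank where "rank i l = (if i then (if l \<le> K then l + n else l) else if l = 0 then n else l)"
    for i l
  have rank_inj: "l = l'" if "rank i l = rank i l'" "l < n" "l' < n" for i l l'
    using that by (auto simp: rank_def split: if_splits)
  have "induces_acyclic A {v \<in> S. c v = i}" for i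
  proof (rule induces_acyclic_by_rank[where g = "\<lambda>v. rank i (k v)"])
    fix a b assume "a \<in> {v \<in> S. c v = i}" "b \<in> {v \<in> S. c v = i}" and ab: "(a, b) \<in> A"
    then have *: "a \<in> S" "b \<in> S" "c a = i" "c b = i" by auto
    show "rank i (k a) \<le> rank i (k b)"
    proof (cases "k a = k b")
      case False
      have kb: "k b = 0 \<or> i = (k b \<le> K)"
        using entry[OF *(1,2) ab False] * by blast
      show ?thesis
      proof (cases i)
        case True
        with kb have "k b \<le> K" by auto
        \<comment> \<open>If \<open>k a\<close> exceeds \<open>K\<close>, then \<open>a\<close> has
          rank below \<open>n\<close> and \<open>b\<close> rank at least \<open>n\<close>; otherwise
          \<open>no_back_low\<close> applies.\<close>
        with True no_back_low[OF *(1,2) ab False] k_less[OF *(1)] show ?thesis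
          by (auto simp: rank_def)
      next
        case i: False
        show ?thesis
        proof (cases "k b = 0")
          case True
          with i False k_less[OF *(1)] show ?thesis
            by (auto simp: rank_def)
        next
          case nz: False
          with i kb have "K < k b" by auto
          moreover from this have "k a \<noteq> 0"
            using Kmax[OF *(1,2) ab] by auto
          ultimately show ?thesis
            using no_back_high[OF *(1,2) ab False] i by (auto simp: rank_def)
        qed
      qed
    qed simp
  next
    fix m
    let ?F = "{v \<in> {v \<in> S. c v = i}. rank i (k v) = m}"
    show "induces_acyclic A ?F"
    proof (cases "?F = {}")
      case True
      then show ?thesis
        unfolding True by (simp add: induces_acyclic_def induced_arcs_def acyclic_def)
    next
      case False
      then obtain w where w: "w \<in> S" "rank i (k w) = m" by auto
      \<comment> \<open>A fibre of the rank lies in one class, where the colouring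
        \<open>cc (k w)\<close> is already acyclic.\<close>
      then have "?F \<subseteq> {v. v \<in> S \<and> k v = k w \<and> cc (k w) v = i}"
        using rank_inj k_less by (auto simp: c_def) metis+
      then show ?thesis
        using cc(1)[OF k_less[OF w(1)], of i] induces_acyclic_subset by blast
    qed
  qed
  moreover have "c x" if x: "x \<in> T" for x
  proof (cases "k x = 0")
    case True
    then show ?thesis
      using cc(2)[of 0 x] n x by (auto simp: M_def c_def)
  next
    case False
    \<comment> \<open>Outside class 0, \<open>x\<close> is dominated by \<open>t\<close> and so is
      an entry of a class up to \<open>K\<close>.\<close>
    with t(2) have "x \<noteq> t" by auto
    with t(3) x have "(t, x) \<in> A" by blast
    then show ?thesis
      using entry[of t x] Kmax[of t x] t T(1) x False by auto
  qed
  ultimately show ?thesis by blast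
qed

section \<open>Induction on the vertex set\<close>

text \<open>Fixing the colour of \<open>T\<close> as True, instead of only asking for a common one,
  lets colourings of separate parts be combined.\<close>

lemma two_colouring:
  assumes "finite S" "T \<subseteq> S" "induces_transitive_tournament A T"
  shows "\<exists>c :: 'a \<Rightarrow> bool. (\<forall>i. induces_acyclic A {v\<in>S. c v = i}) \<and> (\<forall>x\<in>T. c x)"
  using assms
proof (induction arbitrary: T rule: finite_psubset_induct)
  case (psubset S)
  consider (small) "card S < 2"
    | (closed) X where "X \<subset> S" "X \<noteq> {}" "\<And>a b. a \<in> X \<Longrightarrow> b \<in> S - X \<Longrightarrow> (a, b) \<notin> A"
    | (main) "2 \<le> card S" "strongly_connected S"
    unfolding strongly_connected_def by (meson not_le)
  then show ?case
  proof cases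
    case small
    then have "card S \<le> Suc 0" by simp
    then have "x = y" if "x \<in> S" "y \<in> S" for x y
      using that psubset.hyps card_le_Suc0_iff_eq by blast
    then have "induced_arcs A S = {}"
      using asym by (auto simp: induced_arcs_def)
    then have "induces_acyclic A S"
      by (simp add: induces_acyclic_def acyclic_def)
    then have "induces_acyclic A {v \<in> S. True = i}" for i
      by (rule induces_acyclic_subset) auto
    then show ?thesis
      by (intro exI[of _ "\<lambda>_. True"]) simp
  next
    case closed
    obtain c1 :: "'a \<Rightarrow> bool"
      where c1: "\<And>i. induces_acyclic A {v \<in> X. c1 v = i}" "\<And>x. x \<in> T \<inter> X \<Longrightarrow> c1 x"
      using psubset.IH[of X "T \<inter> X"] closed(1)
        induces_transitive_tournament_subset[OF psubset.prems(2), of "T \<inter> X"] by auto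
    have "S - X \<subset> S" "T - X \<subseteq> S - X"
      using closed(1,2) psubset.prems(1) by auto
    then obtain c2 :: "'a \<Rightarrow> bool"
      where c2: "\<And>i. induces_acyclic A {v \<in> S - X. c2 v = i}" "\<And>x. x \<in> T - X \<Longrightarrow> c2 x"
      using psubset.IH[OF \<open>S - X \<subset> S\<close> \<open>T - X \<subseteq> S - X\<close>]
        induces_transitive_tournament_subset[OF psubset.prems(2) Diff_subset] by blast
    define c where "c v = (if v \<in> X then c1 v else c2 v)" for v
    have "induces_acyclic A {v \<in> S. c v = i}" for i
    \<comment> \<open>No arc leaves \<open>X\<close>, so membership in \<open>X\<close> serves as a
      rank.\<close>
    proof (rule induces_acyclic_by_rank[where g = "\<lambda>v. if v \<in> X then 1 else 0"])
      show "(if a \<in> X then 1 else 0) \<le> (if b \<in> X then 1 else (0 :: nat))"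
        if "a \<in> {v \<in> S. c v = i}" "b \<in> {v \<in> S. c v = i}" "(a, b) \<in> A" for a b
        using closed(3) that by auto
      fix m :: nat
      show "induces_acyclic A {v \<in> {v \<in> S. c v = i}. (if v \<in> X then 1 else 0) = m}"
      proof (cases "m = 1")
        case True
        with c1(1)[of i] show ?thesis
          by (elim induces_acyclic_subset) (auto simp: c_def)
      next
        case False
        with c2(1)[of i] show ?thesis
          by (elim induces_acyclic_subset) (auto simp: c_def)
      qed
    qed
    moreover have "c x" if "x \<in> T" for x
      using that c1(2) c2(2) by (simp add: c_def)
    ultimately show ?thesis by blast
  next
    case main
    \<comment> \<open>An empty \<open>T\<close> is replaced by a singleton, since the numbering
      starts at the class of a source \<open>t\<close>.\<close>
    obtain T' where T': "T \<subseteq> T'" "T' \<subseteq> S" "T' \<noteq> {}" "induces_transitive_tournament A T'"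
    proof (cases "T = {}")
      case True
      from main(1) have "S \<noteq> {}" by auto
      then obtain s where "s \<in> S" by blast
      moreover have "induced_arcs A {s} = {}"
        using asym by (auto simp: induced_arcs_def)
      then have "induces_transitive_tournament A {s}"
        by (simp add: induces_transitive_tournament_def induces_tournament_def
          induces_acyclic_def acyclic_def)
      ultimately show thesis
        using that[of "{s}"] True by simp
    next
      case False
      with psubset.prems that[of T] show thesis by simp
    qed
    have "finite T'"
      using T'(2) psubset.hyps by (rule finite_subset)
    then obtain t where t: "t \<in> T'" "\<And>x. x \<in> T' \<Longrightarrow> x \<noteq> t \<Longrightarrow> (t, x) \<in> A"
      by (rule transitive_tournament_source[OF T'(4) _ T'(3)]) (rule that)
    with T' have "t \<in> S" by blast
    then obtain k n where "out_homogeneous S k" "k ` S = {..<n}" "2 \<le> n" "k t = (0::nat)"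
      "\<And>a b v. \<lbrakk>a \<in> S; b \<in> S; v \<in> S; (a, b) \<in> A; k a \<noteq> k b; k v \<noteq> k b;
       k v = Suc (k a) \<or> Suc (k a) = n \<and> k v = 0\<rbrakk> \<Longrightarrow> (v, b) \<in> A"
      by (rule cyclic_numbering[OF psubset.hyps main(1) _ main(2)]) (rule that)
    from two_colouring_of_numbered[OF psubset.hyps this(1-3) t(1) this(4) t(2) T'(2,4) this(5)
        main(2) psubset.IH]
    have "\<exists>c :: 'a \<Rightarrow> bool. (\<forall>i. induces_acyclic A {v\<in>S. c v = i}) \<and> (\<forall>x\<in>T'. c x)" .
    with T'(1) show ?thesis by blast
  qed
qed

end

theorem theorem3p3:
  fixes V :: "'a set" and A :: "('a \<times> 'a) set" and T :: "'a set"
  assumes "oriented_graph V A"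
    and "\<forall>x\<in>V. induces_transitive_tournament A (out_nbhd A x)"
    and "T \<subseteq> V"
    and "induces_transitive_tournament A T"
  shows "\<exists>c :: 'a \<Rightarrow> bool.
           (\<forall>i. induces_acyclic A {v\<in>V. c v = i}) \<and>
           (\<forall>x\<in>T. \<forall>y\<in>T. c x = c y)"
proof -
  \<comment> \<open>The locale speaks of all \<open>x\<close>; outside \<open>V\<close> the
    out-neighbourhood is empty.\<close>
  interpret locally_out_transitive A
  proof
    show "(y, x) \<notin> A" if "(x, y) \<in> A" for x y
      using assms(1) that unfolding oriented_graph_def by blast
    show "induces_transitive_tournament A (out_nbhd A x)" for x
    proof (cases "x \<in> V")
      case False
      then have "out_nbhd A x = {}"
        using assms(1) by (auto simp: oriented_graph_def out_nbhd_def)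
      then show ?thesis
        using induces_transitive_tournament_subset[OF assms(4), of "{}"] by simp
    qed (use assms(2) in blast)
  qed
  have "finite V"
    using assms(1) by (simp add: oriented_graph_def)
  from two_colouring[OF this assms(3,4)] show ?thesis
    by blast
qed

end
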